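(* Let $\mathfrak g$ and $V$ be $n$-Lie algebras, and let $\rho_{\mathfrak g}:\bigwedge^{n-1}\mathfrak g\to\mathrm{End}(V)$, $\rho_V:\bigwedge^{n-1}V\to\mathrm{End}(\mathfrak g)$, $\vartheta_V:V\to\mathrm{Hom}(\bigwedge^{n-1}\mathfrak g,\mathfrak g)$, $\vartheta_{\mathfrak g}:\mathfrak g\to\mathrm{Hom}(\bigwedge^{n-1}V,V)$ be linear maps. The quadruple $(\rho_{\mathfrak g},\rho_V,\vartheta_V,\vartheta_{\mathfrak g})$ is an extreme matched pair if and only if for all $x_1,\dots,x_{n-1},y_1,\dots,y_n\in\mathfrak g$ and $u_1,\dots,u_{n-1},v_1,\dots,v_n\in V$ the following two identities hold: $$\mathcal M_{\mathfrak g}(x_1,u_1;\dots;x_{n-1},u_{n-1};A_0,B_0)=\sum_{i=1}^n\mathcal M_{\mathfrak g}(y_1,v_1;\dots;y_{i-1},v_{i-1};A_i,B_i;y_{i+1},v_{i+1};\dots;y_n,v_n),$$ $$\mathcal M_V(x_1,u_1;\dots;x_{n-1},u_{n-1};A_0,B_0)=\sum_{i=1}^n\mathcal M_V(y_1,v_1;\dots;y_{i-1},v_{i-1};A_i,B_i;y_{i+1},v_{i+1};\dots;y_n,v_n),$$ where $A_0=\mathcal M_{\mathfrak g}(y_1,v_1;\dots;y_n,v_n)$, $B_0=\mathcal M_V(y_1,v_1;\dots;y_n,v_n)$, $A_i=\mathcal M_{\mathfrak g}(x_1,u_1;\dots;x_{n-1},u_{n-1};y_i,v_i)$, $B_i=\mathcal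 M_V(x_1,u_1;\dots;x_{n-1},u_{n-1};y_i,v_i)$ for $1\le i\le n$.
   Context: $K$ is a field of characteristic zero; vector spaces are over $K$, all maps are linear; $n\ge2$; a hat denotes omission. An $n$-Lie algebra is a vector space with an alternating $n$-linear bracket (an $n$-Lie bracket) satisfying $[z_1,\dots,z_{n-1},[w_1,\dots,w_n]]=\sum_{i=1}^n[w_1,\dots,w_{i-1},[z_1,\dots,z_{n-1},w_i],w_{i+1},\dots,w_n]$. For $x_i\in\mathfrak g$, $u_i\in V$ define $$\mathcal M_{\mathfrak g}(x_1,u_1;\dots;x_n,u_n)=[x_1,\dots,x_n]_{\mathfrak g}+\sum_{i=1}^n(-1)^{i-1}\vartheta_V(u_i)(x_1,\dots,\widehat{x_i},\dots,x_n)+\sum_{i=1}^n(-1)^{n-i}\rho_V(u_1,\dots,\widehat{u_i},\dots,u_n)x_i,$$ $$\mathcal M_V(x_1,u_1;\dots;x_n,u_n)=[u_1,\dots,u_n]_V+\sum_{i=1}^n(-1)^{n-i}\rho_{\mathfrak g}(x_1,\dots,\widehat{x_i},\dots,x_n)u_i+\sum_{i=1}^n(-1)^{n-i}\vartheta_{\mathfrak g}(x_i)(u_1,\dots,\widehat{u_i},\dots,u_n).$$ The quadruple is called an extreme matched pair if $[x_1+u_1,\dots,x_n+u_n]_{\bowtie}=\mathcal M_{\mathfrak g}(x_1,u_1;\dots;x_n,u_n)+\mathcal M_V(x_1,u_1;\dots;x_n,u_n)$ is an $n$-Lie bracket on $\mathfrak g\oplus V$. *)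

theory Defs
  imports "HOL-Analysis.Product_Vector"
begin

text \<open>
  Tuples are lists. An \<open>m\<close>-ary operation is a function on lists of which only the values on lists
  of length \<open>m\<close> matter, and positions are counted from \<open>0\<close>: the signs \<open>(-1)^(i-1)\<close> and
  \<open>(-1)^(n-i)\<close> at the 1-based position \<open>i\<close> become \<open>(-1)^i\<close> and \<open>(-1)^(n-1-i)\<close> here.
  A linear map out of the exterior power of order \<open>m\<close> is given, via the universal property, by the
  corresponding alternating \<open>m\<close>-linear map.
\<close>

definition alternating_multilinear ::
    "nat \<Rightarrow> ('k::field \<Rightarrow> 'a::ab_group_add \<Rightarrow> 'a) \<Rightarrow> ('k \<Rightarrow> 'b::ab_group_add \<Rightarrow> 'b) \<Rightarrow> ('a list \<Rightarrow> 'b) \<Rightarrow> bool"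
  where "alternating_multilinear m s1 s2 f \<longleftrightarrow>
    (\<forall>xs i. length xs = m \<and> i < m \<longrightarrow> Vector_Spaces.linear s1 s2 (\<lambda>x. f (xs[i := x]))) \<and>
    (\<forall>xs i j. length xs = m \<and> i < j \<and> j < m \<and> xs ! i = xs ! j \<longrightarrow> f xs = 0)"

definition n_Lie_bracket ::
    "nat \<Rightarrow> ('k::field \<Rightarrow> 'a::ab_group_add \<Rightarrow> 'a) \<Rightarrow> ('a list \<Rightarrow> 'a) \<Rightarrow> bool"
  where "n_Lie_bracket n s br \<longleftrightarrow>
    alternating_multilinear n s s br \<and>
    (\<forall>zs ws. length zs = n - 1 \<and> length ws = n \<longrightarrow>
      br (zs @ [br ws]) = (\<Sum>i<n. br (ws[i := br (zs @ [ws ! i])])))"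

definition n_Lie_algebra ::
    "nat \<Rightarrow> ('k::field \<Rightarrow> 'a::ab_group_add \<Rightarrow> 'a) \<Rightarrow> ('a list \<Rightarrow> 'a) \<Rightarrow> bool"
  where "n_Lie_algebra n s br \<longleftrightarrow> vector_space s \<and> n_Lie_bracket n s br"

text \<open>Linear maps from the exterior power of order \<open>m\<close> of the first space to the endomorphisms of
  the second; the vector space structure on endomorphisms is pointwise.\<close>

definition alternating_End_map ::
    "nat \<Rightarrow> ('k::field \<Rightarrow> 'a::ab_group_add \<Rightarrow> 'a) \<Rightarrow> ('k \<Rightarrow> 'b::ab_group_add \<Rightarrow> 'b) \<Rightarrow> ('a list \<Rightarrow> 'b \<Rightarrow> 'b) \<Rightarrow> bool"
  where "alternating_End_map m s1 s2 \<rho> \<longleftrightarrow>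
    (\<forall>xs. length xs = m \<longrightarrow> Vector_Spaces.linear s2 s2 (\<rho> xs)) \<and>
    (\<forall>v. alternating_multilinear m s1 s2 (\<lambda>xs. \<rho> xs v))"

text \<open>Linear maps from the second space to the linear maps from the exterior power of order \<open>m\<close>
  of the first space to the first space.\<close>

definition linear_Hom_map ::
    "nat \<Rightarrow> ('k::field \<Rightarrow> 'a::ab_group_add \<Rightarrow> 'a) \<Rightarrow> ('k \<Rightarrow> 'b::ab_group_add \<Rightarrow> 'b) \<Rightarrow> ('b \<Rightarrow> 'a list \<Rightarrow> 'a) \<Rightarrow> bool"
  where "linear_Hom_map m s1 s2 \<theta> \<longleftrightarrow>
    (\<forall>u. alternating_multilinear m s1 s1 (\<theta> u)) \<and>
    (\<forall>xs. length xs = m \<longrightarrow> Vector_Spaces.linear s2 s1 (\<lambda>u. \<theta> u xs))"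

definition omit :: "nat \<Rightarrow> 'a list \<Rightarrow> 'a list"
  where "omit i xs = take i xs @ drop (Suc i) xs"

text \<open>\<open>M_g \<dots> [x\<^sub>1, \<dots>, x\<^sub>n] [u\<^sub>1, \<dots>, u\<^sub>n]\<close> stands for the value at
  \<open>(x\<^sub>1, u\<^sub>1; \<dots>; x\<^sub>n, u\<^sub>n)\<close>; likewise \<open>M_V\<close>.\<close>

definition M_g ::
    "nat \<Rightarrow> ('k::field \<Rightarrow> 'g::ab_group_add \<Rightarrow> 'g) \<Rightarrow> ('g list \<Rightarrow> 'g) \<Rightarrow>
     ('v \<Rightarrow> 'g list \<Rightarrow> 'g) \<Rightarrow> ('v list \<Rightarrow> 'g \<Rightarrow> 'g) \<Rightarrow> 'g list \<Rightarrow> 'v list \<Rightarrow> 'g"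
  where "M_g n s\<^sub>g br\<^sub>g \<theta>\<^sub>V \<rho>\<^sub>V xs us =
    br\<^sub>g xs
    + (\<Sum>i<n. s\<^sub>g ((-1) ^ i) (\<theta>\<^sub>V (us ! i) (omit i xs)))
    + (\<Sum>i<n. s\<^sub>g ((-1) ^ (n - 1 - i)) (\<rho>\<^sub>V (omit i us) (xs ! i)))"

definition M_V ::
    "nat \<Rightarrow> ('k::field \<Rightarrow> 'v::ab_group_add \<Rightarrow> 'v) \<Rightarrow> ('v list \<Rightarrow> 'v) \<Rightarrow>
     ('g list \<Rightarrow> 'v \<Rightarrow> 'v) \<Rightarrow> ('g \<Rightarrow> 'v list \<Rightarrow> 'v) \<Rightarrow> 'g list \<Rightarrow> 'v list \<Rightarrow> 'v"
  where "M_V n s\<^sub>V br\<^sub>V \<rho>\<^sub>g \<theta>\<^sub>g xs us =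
    br\<^sub>V us
    + (\<Sum>i<n. s\<^sub>V ((-1) ^ (n - 1 - i)) (\<rho>\<^sub>g (omit i xs) (us ! i)))
    + (\<Sum>i<n. s\<^sub>V ((-1) ^ (n - 1 - i)) (\<theta>\<^sub>g (xs ! i) (omit i us)))"

text \<open>The direct sum is the product type, \<open>x + u\<close> being the pair \<open>(x, u)\<close>.\<close>

definition extreme_matched_pair ::
    "nat \<Rightarrow> ('k::field \<Rightarrow> 'g::ab_group_add \<Rightarrow> 'g) \<Rightarrow> ('k \<Rightarrow> 'v::ab_group_add \<Rightarrow> 'v) \<Rightarrow>
     ('g list \<Rightarrow> 'g) \<Rightarrow> ('v list \<Rightarrow> 'v) \<Rightarrow>
     ('g list \<Rightarrow> 'v \<Rightarrow> 'v) \<Rightarrow> ('v list \<Rightarrow> 'g \<Rightarrow> 'g) \<Rightarrow>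
     ('v \<Rightarrow> 'g list \<Rightarrow> 'g) \<Rightarrow> ('g \<Rightarrow> 'v list \<Rightarrow> 'v) \<Rightarrow> bool"
  where "extreme_matched_pair n s\<^sub>g s\<^sub>V br\<^sub>g br\<^sub>V \<rho>\<^sub>g \<rho>\<^sub>V \<theta>\<^sub>V \<theta>\<^sub>g \<longleftrightarrow>
    n_Lie_bracket n (module_prod.scale s\<^sub>g s\<^sub>V)
      (\<lambda>zs. (M_g n s\<^sub>g br\<^sub>g \<theta>\<^sub>V \<rho>\<^sub>V (map fst zs) (map snd zs),
             M_V n s\<^sub>V br\<^sub>V \<rho>\<^sub>g \<theta>\<^sub>g (map fst zs) (map snd zs)))"

end

theory Submission
  imports Defs
begin

text \<open>
  The fundamental identity for the bracket on the direct sum is an equation between pairs of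
  vectors; read off component by component, it is exactly the pair of identities of the theorem,
  since a list of pairs is the same as a pair of lists of equal length. So the content of the theorem
  is that the bracket is \<^emph>\<open>always\<close> alternating and multilinear.

  The reason is that each of the four sums in \<open>M_g\<close> and \<open>M_V\<close> is, up to the global sign
  \<open>(-1)^(n-1)\<close>, an alternating sum \<open>\<Sum>i. (-1)^i g(z\<^sub>i)(z\<^sub>0, \<dots>, omit z\<^sub>i, \<dots>)\<close> in which \<open>g\<close> sends
  vectors linearly to alternating \<open>(n-1)\<close>-linear maps: the four maps \<open>\<rho>\<close> and \<open>\<theta>\<close> are pulled back
  to the direct sum along the projections. Such a sum is alternating (lemma
  \<open>alternating_multilinear_alternating_sum\<close>): if \<open>z\<^sub>i = z\<^sub>j\<close>, only the terms omitting position \<open>i\<close>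
  or \<open>j\<close> can survive, and these cancel because the two remaining lists differ by moving one entry
  across \<open>j - i - 1\<close> others.
\<close>

section \<open>Alternating multilinear maps\<close>

lemma linear_iff_add_scale:
  "Vector_Spaces.linear s1 s2 f \<longleftrightarrow> vector_space s1 \<and> vector_space s2 \<and>
    (\<forall>x y. f (x + y) = f x + f y) \<and> (\<forall>c x. f (s1 c x) = s2 c (f x))"
  by (auto simp: module_hom_iff_linear[symmetric] module_hom_iff module_iff_vector_space)

lemma alternating_multilinear_add:
  assumes "alternating_multilinear m s1 s2 f" "alternating_multilinear m s1 s2 g"
  shows "alternating_multilinear m s1 s2 (\<lambda>xs. f xs + g xs)"
  using assms
  by (auto simp: alternating_multilinear_def linear_iff_add_scale module.scale_right_distrib
      module_iff_vector_space ac_simps)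

lemma alternating_multilinear_scale:
  assumes "alternating_multilinear m s1 s2 f"
  shows "alternating_multilinear m s1 s2 (\<lambda>xs. s2 c (f xs))"
proof (cases m)
  case (Suc k)
  then have "vector_space s2"
    using assms Ex_list_of_length[of m]
    unfolding alternating_multilinear_def linear_iff_add_scale by (metis zero_less_Suc)
  then interpret vector_space s2 .
  show ?thesis
    using assms
    by (auto simp: alternating_multilinear_def linear_iff_add_scale scale_right_distrib mult.commute)
qed (simp add: alternating_multilinear_def)

lemma alternating_multilinear_Pair:
  assumes "alternating_multilinear m s s1 f" "alternating_multilinear m s s2 g"
    and "vector_space s1" "vector_space s2"
  shows "alternating_multilinear m s (module_prod.scale s1 s2) (\<lambda>xs. (f xs, g xs))"
proof -
  interpret vector_space_prod s1 s2
    using assms(3,4) by (simp add: vector_space_prod_def vector_space_pair_def)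
  show ?thesis
    using assms(1,2) p.vector_space_axioms
    by (auto simp: alternating_multilinear_def linear_iff_add_scale scale_prod zero_prod_def)
qed

lemma alternating_multilinear_compose_map:
  assumes f: "alternating_multilinear m s1 s2 f" and p: "Vector_Spaces.linear s s1 p"
  shows "alternating_multilinear m s s2 (\<lambda>zs. f (map p zs))"
  unfolding alternating_multilinear_def
proof (intro conjI allI impI)
  fix zs :: "'d list" and i assume "length zs = m \<and> i < m"
  then have "Vector_Spaces.linear s1 s2 (\<lambda>x. f ((map p zs)[i := x]))"
    using f by (simp add: alternating_multilinear_def)
  with p show "Vector_Spaces.linear s s2 (\<lambda>z. f (map p (zs[i := z])))"
    by (simp add: linear_iff_add_scale map_update)
next
  fix zs :: "'d list" and i j assume "length zs = m \<and> i < j \<and> j < m \<and> zs ! i = zs ! j"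
  then have "length (map p zs) = m \<and> i < j \<and> j < m \<and> map p zs ! i = map p zs ! j"
    by simp
  with f show "f (map p zs) = 0"
    unfolding alternating_multilinear_def by blast
qed

lemma alternating_swap:
  assumes f: "alternating_multilinear m s1 s2 f" and len: "length (a @ x # y # c) = m"
  shows "f (a @ x # y # c) = - f (a @ y # x # c)"
proof -
  let ?p = "length a"
  have add: "f (zs[i := v + w]) = f (zs[i := v]) + f (zs[i := w])"
    if "length zs = m" "i < m" for zs i v w
    using f that by (simp add: alternating_multilinear_def linear_iff_add_scale)
  have add1: "f (a @ (v + w) # z # c) = f (a @ v # z # c) + f (a @ w # z # c)" for v w z
    using add[of "a @ x # z # c" ?p v w] len by simp
  have add2: "f (a @ z # (v + w) # c) = f (a @ z # v # c) + f (a @ z # w # c)" for v w z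
    using add[of "a @ z # y # c" "Suc ?p" v w] len by (simp add: list_update_append)
  have diag: "f (a @ z # z # c) = 0" for z
  proof -
    have "(a @ z # z # c) ! ?p = (a @ z # z # c) ! Suc ?p"
      by (simp add: nth_append)
    moreover have "length (a @ z # z # c) = m" "Suc ?p < m"
      using len by simp_all
    ultimately show ?thesis
      using f lessI unfolding alternating_multilinear_def by blast
  qed
  \<comment> \<open>Polarization of \<open>diag\<close>.\<close>
  have "0 = f (a @ (x + y) # (x + y) # c)"
    by (simp add: diag)
  also have "\<dots> = f (a @ x # x # c) + f (a @ y # x # c) + (f (a @ x # y # c) + f (a @ y # y # c))"
    by (simp only: add1 add2)
  also have "\<dots> = f (a @ x # y # c) + f (a @ y # x # c)"
    by (simp add: diag)
  finally show ?thesis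
    by (metis eq_neg_iff_add_eq_0)
qed

lemma alternating_move:
  assumes f: "alternating_multilinear m s1 s2 f" and "vector_space s2"
    and "length (a @ z # b @ c) = m"
  shows "f (a @ b @ z # c) = s2 ((-1) ^ length b) (f (a @ z # b @ c))"
  using assms(3)
proof (induction b arbitrary: a)
  case Nil
  interpret vector_space s2 by fact
  show ?case by simp
next
  case (Cons y b)
  interpret vector_space s2 by fact
  have "f (a @ (y # b) @ z # c) = s2 ((-1) ^ length b) (f (a @ y # z # b @ c))"
    using Cons.IH[of "a @ [y]"] Cons.prems by simp
  also have "f (a @ y # z # b @ c) = - f (a @ z # y # b @ c)"
    using alternating_swap[OF f, of a y z "b @ c"] Cons.prems by simp
  finally show ?case by simp
qed

section \<open>Alternating sums over an omitted argument\<close>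

lemma length_omit: "i < length xs \<Longrightarrow> length (omit i xs) = length xs - 1"
  by (simp add: omit_def)

lemma map_omit: "map f (omit i xs) = omit i (map f xs)"
  by (simp add: omit_def take_map drop_map)

lemma nth_omit: "k < length xs - 1 \<Longrightarrow> omit i xs ! k = xs ! (if k < i then k else Suc k)"
  by (auto simp: omit_def nth_append min_def)

lemma omit_list_update_same: "omit i (xs[i := x]) = omit i xs"
  by (simp add: omit_def)

lemma omit_list_update_other:
  assumes "i \<noteq> k" "i < length xs" "k < length xs"
  shows "omit i (xs[k := x]) = (omit i xs)[if k < i then k else k - 1 := x]"
  using assms by (intro nth_equalityI) (auto simp: length_omit nth_omit nth_list_update)

lemma omit_append_Cons: "omit (length a) (a @ z # b) = a @ b"
  by (simp add: omit_def)

text \<open>Omitting \<open>z\<^sub>i\<close> and omitting \<open>z\<^sub>j = z\<^sub>i\<close> leave the same entries, with the common one placed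
  before or after the \<open>j - i - 1\<close> entries that lie strictly between.\<close>

lemma alternating_omit_equal_entries:
  assumes f: "alternating_multilinear m s1 s2 f" and s2: "vector_space s2"
    and zs: "length zs = Suc m" "i < j" "j < Suc m" "zs ! i = zs ! j"
  shows "s2 ((-1) ^ i) (f (omit i zs)) + s2 ((-1) ^ j) (f (omit j zs)) = 0"
proof -
  interpret vector_space s2 by fact
  define a b c z where "a = take i zs" and "b = take (j - Suc i) (drop (Suc i) zs)"
    and "c = drop (Suc j) zs" and "z = zs ! i"
  have split: "zs = a @ z # b @ z # c"
  proof -
    have "drop (Suc i) zs = b @ drop j zs"
      using zs(2) append_take_drop_id[of "j - Suc i" "drop (Suc i) zs"] by (simp add: b_def)
    moreover have "drop j zs = z # c"
      using zs by (simp add: Cons_nth_drop_Suc c_def z_def)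
    moreover have "zs = a @ z # drop (Suc i) zs"
      using zs id_take_nth_drop[of i zs] by (simp add: a_def z_def)
    ultimately show ?thesis by simp
  qed
  have i: "i = length a" and j: "j = length (a @ z # b)"
    using zs by (simp_all add: a_def b_def)
  have "omit i zs = a @ b @ z # c"
    unfolding i by (subst split) (rule omit_append_Cons)
  moreover have "omit j zs = a @ z # b @ c"
    unfolding j using omit_append_Cons[of "a @ z # b" z c] by (subst split) simp
  moreover have "length (a @ z # b @ c) = m"
    using zs(1) by (subst (asm) split) simp
  ultimately show ?thesis
    by (simp add: alternating_move[OF f s2] i j power_add)
qed

text \<open>This is skew-symmetrization of a map that is already alternating in all arguments but the
  first; for \<open>g z zs = \<alpha> z * \<omega> zs\<close> with scalar forms \<open>\<alpha>\<close> and \<open>\<omega>\<close> it is the wedge product of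
  \<open>\<alpha>\<close> and \<open>\<omega>\<close>. Multilinearity holds term by term: updating position \<open>k\<close> changes the first
  argument of \<open>g\<close> in the \<open>k\<close>-th term and one entry of the remaining list in the others.\<close>

lemma alternating_multilinear_alternating_sum:
  fixes s1 :: "'k::field \<Rightarrow> 'a::ab_group_add \<Rightarrow> 'a" and s2 :: "'k \<Rightarrow> 'b::ab_group_add \<Rightarrow> 'b"
  assumes alt: "\<And>z. alternating_multilinear m s1 s2 (g z)"
    and lin: "\<And>zs. length zs = m \<Longrightarrow> Vector_Spaces.linear s1 s2 (\<lambda>z. g z zs)"
  shows "alternating_multilinear (Suc m) s1 s2
           (\<lambda>zs. \<Sum>i<Suc m. s2 ((-1) ^ i) (g (zs ! i) (omit i zs)))"
  unfolding alternating_multilinear_def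
proof (intro conjI allI impI)
  \<comment> \<open>Linearity of \<open>g\<close> at any one list contains the vector space axioms.\<close>
  obtain ws :: "'a list" where "length ws = m"
    using Ex_list_of_length by blast
  from lin[OF this] have "vector_space s1" and s2: "vector_space s2"
    by (simp_all add: linear_iff_add_scale)
  interpret s1: vector_space s1 by fact
  interpret s2: vector_space s2 by fact
  {
    fix zs :: "'a list" and k
    assume zs: "length zs = Suc m \<and> k < Suc m"
    let ?h = "\<lambda>i z. g (zs[k := z] ! i) (omit i (zs[k := z]))"
    have h: "Vector_Spaces.linear s1 s2 (?h i)" if i: "i < Suc m" for i
    proof (cases "i = k")
      case True
      with zs show ?thesis
        using lin[of "omit k zs"] by (simp add: omit_list_update_same length_omit)
    next
      case False
      define k' where "k' = (if k < i then k else k - 1)"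
      have "?h i = (\<lambda>z. g (zs ! i) ((omit i zs)[k' := z]))"
        using False zs i by (simp add: omit_list_update_other k'_def)
      moreover have "k' < m" "length (omit i zs) = m"
        using False zs i by (auto simp: k'_def length_omit)
      ultimately show ?thesis
        using alt[of "zs ! i"] by (simp add: alternating_multilinear_def)
    qed
    show "Vector_Spaces.linear s1 s2 (\<lambda>z. \<Sum>i<Suc m. s2 ((-1) ^ i) (?h i z))"
      unfolding linear_iff_add_scale
    proof (intro conjI allI)
      fix x y c
      have "?h i (x + y) = ?h i x + ?h i y" "?h i (s1 c x) = s2 c (?h i x)" if "i < Suc m" for i
        using h[OF that] unfolding linear_iff_add_scale by blast+
      then show "(\<Sum>i<Suc m. s2 ((-1) ^ i) (?h i (x + y)))
            = (\<Sum>i<Suc m. s2 ((-1) ^ i) (?h i x)) + (\<Sum>i<Suc m. s2 ((-1) ^ i) (?h i y))"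
        and "(\<Sum>i<Suc m. s2 ((-1) ^ i) (?h i (s1 c x)))
            = s2 c (\<Sum>i<Suc m. s2 ((-1) ^ i) (?h i x))"
        by (simp_all add: s2.scale_right_distrib sum.distrib s2.scale_sum_right mult.commute
            del: sum.lessThan_Suc)
    qed fact+
  next
    fix zs :: "'a list" and i j
    assume zs: "length zs = Suc m \<and> i < j \<and> j < Suc m \<and> zs ! i = zs ! j"
    let ?t = "\<lambda>k. s2 ((-1) ^ k) (g (zs ! k) (omit k zs))"
    have "?t k = 0" if k: "k < Suc m" "k \<noteq> i" "k \<noteq> j" for k
    proof -
      define i' j' where "i' = (if i < k then i else i - 1)" and "j' = (if j < k then j else j - 1)"
      have "i' < j'" "j' < m"
        using zs k by (auto simp: i'_def j'_def)
      moreover have "omit k zs ! i' = omit k zs ! j'"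
        using zs k by (auto simp: i'_def j'_def nth_omit)
      moreover have "length (omit k zs) = m"
        using zs k by (simp add: length_omit)
      ultimately have "g (zs ! k) (omit k zs) = 0"
        using alt[of "zs ! k"] unfolding alternating_multilinear_def by blast
      then show ?thesis by simp
    qed
    then have "sum ?t {..<Suc m} = sum ?t {i, j}"
      using zs by (intro sum.mono_neutral_right) auto
    also have "\<dots> = ?t i + ?t j"
      using zs by auto
    also have "\<dots> = 0"
      using alternating_omit_equal_entries[OF alt s2, of zs i j] zs by simp
    finally show "sum ?t {..<Suc m} = 0" .
  }
qed

text \<open>The signs \<open>(-1)^(n-1-i)\<close> differ from \<open>(-1)^i\<close> by the factor \<open>(-1)^(n-1)\<close>, which does not
  depend on \<open>i\<close>.\<close>

lemma alternating_multilinear_alternating_sum_rev: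
  fixes s1 :: "'k::field \<Rightarrow> 'a::ab_group_add \<Rightarrow> 'a" and s2 :: "'k \<Rightarrow> 'b::ab_group_add \<Rightarrow> 'b"
  assumes alt: "\<And>z. alternating_multilinear m s1 s2 (g z)"
    and lin: "\<And>zs. length zs = m \<Longrightarrow> Vector_Spaces.linear s1 s2 (\<lambda>z. g z zs)"
  shows "alternating_multilinear (Suc m) s1 s2
           (\<lambda>zs. \<Sum>i<Suc m. s2 ((-1) ^ (m - i)) (g (zs ! i) (omit i zs)))"
proof -
  \<comment> \<open>Linearity of \<open>g\<close> at any one list contains the vector space axioms.\<close>
  obtain ws :: "'a list" where "length ws = m"
    using Ex_list_of_length by blast
  from lin[OF this] interpret s2: vector_space s2
    by (simp add: linear_iff_add_scale)
  have "((-1) ^ (m - i) :: 'k) = (-1) ^ m * (-1) ^ i" if "i < Suc m" for i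
    using that by (auto simp: uminus_power_if)
  then have "(\<Sum>i<Suc m. s2 ((-1) ^ (m - i)) (g (zs ! i) (omit i zs)))
      = s2 ((-1) ^ m) (\<Sum>i<Suc m. s2 ((-1) ^ i) (g (zs ! i) (omit i zs)))" for zs
    by (simp add: s2.scale_sum_right del: sum.lessThan_Suc)
  then show ?thesis
    using alternating_multilinear_scale[OF alternating_multilinear_alternating_sum[OF alt lin]]
    by simp
qed

section \<open>The bracket on the direct sum\<close>

text \<open>Maps \<open>\<rho>\<close> and \<open>\<theta>\<close>, pulled back along linear maps to a single space, are of the shape
  required of the summands in an alternating sum.\<close>

lemma alternating_End_map_pullback:
  assumes "alternating_End_map m s1 s2 \<rho>"
    and "Vector_Spaces.linear s s1 p" "Vector_Spaces.linear s s2 q"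
  shows "alternating_multilinear m s s2 (\<lambda>zs. \<rho> (map p zs) (q z))"
    and "length zs = m \<Longrightarrow> Vector_Spaces.linear s s2 (\<lambda>z. \<rho> (map p zs) (q z))"
  using assms alternating_multilinear_compose_map[of m s1 s2 "\<lambda>xs. \<rho> xs (q z)" s p]
  by (auto simp: alternating_End_map_def linear_iff_add_scale)

lemma linear_Hom_map_pullback:
  assumes "linear_Hom_map m s1 s2 \<theta>"
    and "Vector_Spaces.linear s s1 p" "Vector_Spaces.linear s s2 q"
  shows "alternating_multilinear m s s1 (\<lambda>zs. \<theta> (q z) (map p zs))"
    and "length zs = m \<Longrightarrow> Vector_Spaces.linear s s1 (\<lambda>z. \<theta> (q z) (map p zs))"
  using assms alternating_multilinear_compose_map[of m s1 s1 "\<theta> (q z)" s p]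
  by (auto simp: linear_Hom_map_def linear_iff_add_scale)

lemma alternating_multilinear_cong:
  assumes "alternating_multilinear m s1 s2 f" "\<And>xs. length xs = m \<Longrightarrow> f xs = g xs"
  shows "alternating_multilinear m s1 s2 g"
  using assms by (simp add: alternating_multilinear_def)

lemma alternating_multilinear_M_g:
  assumes br: "alternating_multilinear (Suc m) s\<^sub>g s\<^sub>g br\<^sub>g"
    and \<rho>: "alternating_End_map m s\<^sub>V s\<^sub>g \<rho>\<^sub>V" and \<theta>: "linear_Hom_map m s\<^sub>g s\<^sub>V \<theta>\<^sub>V"
    and p: "Vector_Spaces.linear s s\<^sub>g p" and q: "Vector_Spaces.linear s s\<^sub>V q"
  shows "alternating_multilinear (Suc m) s s\<^sub>g
           (\<lambda>zs. M_g (Suc m) s\<^sub>g br\<^sub>g \<theta>\<^sub>V \<rho>\<^sub>V (map p zs) (map q zs))"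
  by (rule alternating_multilinear_cong[OF alternating_multilinear_add[OF
        alternating_multilinear_add[OF alternating_multilinear_compose_map[OF br p]
          alternating_multilinear_alternating_sum[OF linear_Hom_map_pullback[OF \<theta> p q]]]
        alternating_multilinear_alternating_sum_rev[OF alternating_End_map_pullback[OF \<rho> q p]]]])
    (simp_all add: M_g_def map_omit del: sum.lessThan_Suc)

lemma alternating_multilinear_M_V:
  assumes br: "alternating_multilinear (Suc m) s\<^sub>V s\<^sub>V br\<^sub>V"
    and \<rho>: "alternating_End_map m s\<^sub>g s\<^sub>V \<rho>\<^sub>g" and \<theta>: "linear_Hom_map m s\<^sub>V s\<^sub>g \<theta>\<^sub>g"
    and p: "Vector_Spaces.linear s s\<^sub>g p" and q: "Vector_Spaces.linear s s\<^sub>V q"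
  shows "alternating_multilinear (Suc m) s s\<^sub>V
           (\<lambda>zs. M_V (Suc m) s\<^sub>V br\<^sub>V \<rho>\<^sub>g \<theta>\<^sub>g (map p zs) (map q zs))"
  by (rule alternating_multilinear_cong[OF alternating_multilinear_add[OF
        alternating_multilinear_add[OF alternating_multilinear_compose_map[OF br q]
          alternating_multilinear_alternating_sum_rev[OF alternating_End_map_pullback[OF \<rho> p q]]]
        alternating_multilinear_alternating_sum_rev[OF linear_Hom_map_pullback[OF \<theta> q p]]]])
    (simp_all add: M_V_def map_omit del: sum.lessThan_Suc)

lemma all_pair_lists_iff:
  "(\<forall>zs. length zs = m \<longrightarrow> P (map fst zs) (map snd zs))
    \<longleftrightarrow> (\<forall>xs us. length xs = m \<and> length us = m \<longrightarrow> P xs us)"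
  by (metis length_map length_zip map_fst_zip map_snd_zip min.idem)

theorem theorem6p2:
  fixes n :: nat
    and s\<^sub>g :: "'k::field_char_0 \<Rightarrow> 'g::ab_group_add \<Rightarrow> 'g"
    and s\<^sub>V :: "'k \<Rightarrow> 'v::ab_group_add \<Rightarrow> 'v"
    and br\<^sub>g :: "'g list \<Rightarrow> 'g"
    and br\<^sub>V :: "'v list \<Rightarrow> 'v"
    and \<rho>\<^sub>g :: "'g list \<Rightarrow> 'v \<Rightarrow> 'v"
    and \<rho>\<^sub>V :: "'v list \<Rightarrow> 'g \<Rightarrow> 'g"
    and \<theta>\<^sub>V :: "'v \<Rightarrow> 'g list \<Rightarrow> 'g"
    and \<theta>\<^sub>g :: "'g \<Rightarrow> 'v list \<Rightarrow> 'v"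
  assumes "n \<ge> 2"
    and "n_Lie_algebra n s\<^sub>g br\<^sub>g"
    and "n_Lie_algebra n s\<^sub>V br\<^sub>V"
    and "alternating_End_map (n - 1) s\<^sub>g s\<^sub>V \<rho>\<^sub>g"
    and "alternating_End_map (n - 1) s\<^sub>V s\<^sub>g \<rho>\<^sub>V"
    and "linear_Hom_map (n - 1) s\<^sub>g s\<^sub>V \<theta>\<^sub>V"
    and "linear_Hom_map (n - 1) s\<^sub>V s\<^sub>g \<theta>\<^sub>g"
  shows "extreme_matched_pair n s\<^sub>g s\<^sub>V br\<^sub>g br\<^sub>V \<rho>\<^sub>g \<rho>\<^sub>V \<theta>\<^sub>V \<theta>\<^sub>g \<longleftrightarrow>
    (\<forall>xs us ys vs. length xs = n - 1 \<and> length us = n - 1 \<and> length ys = n \<and> length vs = n \<longrightarrow>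
      (let Mg = M_g n s\<^sub>g br\<^sub>g \<theta>\<^sub>V \<rho>\<^sub>V;
           MV = M_V n s\<^sub>V br\<^sub>V \<rho>\<^sub>g \<theta>\<^sub>g;
           A\<^sub>0 = Mg ys vs;
           B\<^sub>0 = MV ys vs;
           A = (\<lambda>i. Mg (xs @ [ys ! i]) (us @ [vs ! i]));
           B = (\<lambda>i. MV (xs @ [ys ! i]) (us @ [vs ! i]))
       in Mg (xs @ [A\<^sub>0]) (us @ [B\<^sub>0]) = (\<Sum>i<n. Mg (ys[i := A i]) (vs[i := B i])) \<and>
          MV (xs @ [A\<^sub>0]) (us @ [B\<^sub>0]) = (\<Sum>i<n. MV (ys[i := A i]) (vs[i := B i]))))"
proof -
  let ?Mg = "M_g n s\<^sub>g br\<^sub>g \<theta>\<^sub>V \<rho>\<^sub>V" and ?MV = "M_V n s\<^sub>V br\<^sub>V \<rho>\<^sub>g \<theta>\<^sub>g"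
  let ?s = "module_prod.scale s\<^sub>g s\<^sub>V"
  define br where "br = (\<lambda>zs. (?Mg (map fst zs) (map snd zs), ?MV (map fst zs) (map snd zs)))"
  obtain m where n: "n = Suc m"
    using \<open>n \<ge> 2\<close> by (cases n) auto
  have vs: "vector_space s\<^sub>g" "vector_space s\<^sub>V"
    and br_alt: "alternating_multilinear n s\<^sub>g s\<^sub>g br\<^sub>g" "alternating_multilinear n s\<^sub>V s\<^sub>V br\<^sub>V"
    using assms(2,3) by (simp_all add: n_Lie_algebra_def n_Lie_bracket_def)
  interpret vector_space_prod s\<^sub>g s\<^sub>V
    using vs by (simp add: vector_space_prod_def vector_space_pair_def)
  have lin: "Vector_Spaces.linear ?s s\<^sub>g fst" "Vector_Spaces.linear ?s s\<^sub>V snd"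
    using vs p.vector_space_axioms by (simp_all add: linear_iff_add_scale scale_def)
  have "alternating_multilinear n ?s ?s br"
    unfolding br_def n
    using alternating_multilinear_M_g[OF _ _ _ lin] alternating_multilinear_M_V[OF _ _ _ lin]
      assms(4-7) br_alt vs n by (simp add: alternating_multilinear_Pair)
  then have emp: "extreme_matched_pair n s\<^sub>g s\<^sub>V br\<^sub>g br\<^sub>V \<rho>\<^sub>g \<rho>\<^sub>V \<theta>\<^sub>V \<theta>\<^sub>g \<longleftrightarrow>
      (\<forall>zs ws. length zs = n - 1 \<and> length ws = n \<longrightarrow>
        br (zs @ [br ws]) = (\<Sum>i<n. br (ws[i := br (zs @ [ws ! i])])))"
    unfolding extreme_matched_pair_def n_Lie_bracket_def br_def by blast
  define fundamental where "fundamental = (\<lambda>xs us ys vs.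
    let A = (\<lambda>i. ?Mg (xs @ [ys ! i]) (us @ [vs ! i]));
        B = (\<lambda>i. ?MV (xs @ [ys ! i]) (us @ [vs ! i]))
    in ?Mg (xs @ [?Mg ys vs]) (us @ [?MV ys vs]) = (\<Sum>i<n. ?Mg (ys[i := A i]) (vs[i := B i])) \<and>
       ?MV (xs @ [?Mg ys vs]) (us @ [?MV ys vs]) = (\<Sum>i<n. ?MV (ys[i := A i]) (vs[i := B i])))"
  have "br (zs @ [br ws]) = (\<Sum>i<n. br (ws[i := br (zs @ [ws ! i])]))
      \<longleftrightarrow> fundamental (map fst zs) (map snd zs) (map fst ws) (map snd ws)"
    if "length ws = n" for zs ws
    using that by (simp add: br_def fundamental_def Let_def prod_eq_iff fst_sum snd_sum map_update)
  with emp have "extreme_matched_pair n s\<^sub>g s\<^sub>V br\<^sub>g br\<^sub>V \<rho>\<^sub>g \<rho>\<^sub>V \<theta>\<^sub>V \<theta>\<^sub>g \<longleftrightarrow>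
      (\<forall>zs. length zs = n - 1 \<longrightarrow> (\<forall>ws. length ws = n \<longrightarrow>
        fundamental (map fst zs) (map snd zs) (map fst ws) (map snd ws)))"
    by blast
  also have "\<dots> \<longleftrightarrow> (\<forall>xs us. length xs = n - 1 \<and> length us = n - 1 \<longrightarrow>
      (\<forall>ys vs. length ys = n \<and> length vs = n \<longrightarrow> fundamental xs us ys vs))"
    using all_pair_lists_iff[of "n - 1"
        "\<lambda>xs us. \<forall>ws. length ws = n \<longrightarrow> fundamental xs us (map fst ws) (map snd ws)"]
      all_pair_lists_iff[of n "fundamental _ _"]
    by simp
  finally show ?thesis
    unfolding fundamental_def Let_def by blast
qed

end
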